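(* Achievability of $(\ell,s)$ does not imply that $(\ell,s')$ is achievable for any $s'\neq s$. That is, there exist a PPICOD problem (given by a preference matrix $\boldsymbol{P}$) and a pair $(\ell,s)$ that is achievable for it, such that for no $s'\neq s$ is the pair $(\ell,s')$ achievable.
   Context: Preferential pliable index coding (PPICOD). A sender has $m\ge 1$ messages $X_{[1:m]}=(X_1,\dots,X_m)$, each taking values in a finite field $\mathbb{F}_q$ of size $q$, where $[a:b]=\{a,a+1,\dots,b\}$ and $X_S=(X_i:i\in S)$. There are $n\ge 1$ receivers; receiver $i\in[1:n]$ already knows $X_{H_i}$ for some $H_i\subsetneq[1:m]$. The problem is described by an $n\times m$ preference matrix $\boldsymbol{P}=[P_{i,j}]$ with entries in $\mathbb{R}\cup\{\infty\}$, where $P_{i,j}$ is the preference rank receiver $i$ gives to $X_j$ (lower is better); $P_{i,j}$ is finite if $j\in[1:m]\setminus H_i$ and $P_{i,j}=\infty$ if $j\in H_i$. A (linear) code of length $\ell$ consists of: an encoding function $\mathsf{E}:\mathbb{F}_q^m\to\mathbb{F}_q^\ell$ of the form $\mathsf{E}(X_{[1:m]})=\boldsymbol{A}\boldsymbol{X}$ with $\boldsymbol{A}\in\mathbb{F}_q^{\ell\times m}$ and $\boldsymbol{X}=[X_1\;\cdots\;X_m]^{\mathrm T}$; a decoding choice $D:[1:n]\to[1:m]$; and for each $i\in[1:n]$ a decoding function $\mathsf{G}_i:\mathbb{F}_q^\ell\times\mathbb{F}_q^{|H_i|}\to\mathbb{F}_q$; such that $D(i)\in[1:m]\setminus H_i$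 and $\mathsf{G}_i(\mathsf{E}(X_{[1:m]}),X_{H_i})=X_{D(i)}$ for all $i\in[1:n]$ and all $X_{[1:m]}\in\mathbb{F}_q^m$. Only linear encoding functions are considered. The overall satisfaction metric of the code is $s=\sum_{i=1}^n P_{i,D(i)}$. A pair $(\ell,s)$ is achievable if there is a code with code length $\ell$ and overall satisfaction metric $s$. *)

theory Defs
  imports "Jordan_Normal_Form.Matrix" "HOL-Library.Extended_Real"
begin

text \<open>
  Receivers and messages are numbered from 0, following the indexing of vectors and matrices:
  a problem with \<open>n\<close> receivers and \<open>m\<close> messages is an \<open>n \<times> m\<close> preference matrix \<open>P\<close>, with
  receivers \<open>i < n\<close> and messages \<open>j < m\<close>. The side information of a receiver can be read off
  from \<open>P\<close>, since a preference rank is infinite exactly at the messages already known.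
\<close>

definition side_info :: "ereal mat \<Rightarrow> nat \<Rightarrow> nat set" where
  "side_info P i = {j. j < dim_col P \<and> P $$ (i, j) = \<infinity>}"

definition ppicod_problem :: "ereal mat \<Rightarrow> bool" where
  "ppicod_problem P \<longleftrightarrow>
     1 \<le> dim_row P \<and> 1 \<le> dim_col P \<and>
     (\<forall>i < dim_row P. \<forall>j < dim_col P. P $$ (i, j) \<noteq> -\<infinity>) \<and>
     (\<forall>i < dim_row P. side_info P i \<subset> {..<dim_col P})"

text \<open>\<open>subvec x S\<close> is the vector of length \<open>card S\<close> of the entries of \<open>x\<close> at the positions in
  \<open>S\<close>, in increasing order (for \<open>S \<subseteq> {..<dim_vec x}\<close>).\<close>

definition subvec :: "'a vec \<Rightarrow> nat set \<Rightarrow> 'a vec" where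
  "subvec x S = vec_of_list (nths (list_of_vec x) S)"

text \<open>\<open>G i\<close> is only ever applied to a codeword of length \<open>l\<close> and a vector of length
  \<open>card (side_info P i)\<close>; its values elsewhere, and those of \<open>D\<close> and \<open>G\<close> at
  \<open>i \<ge> dim_row P\<close>, are irrelevant.\<close>

definition linear_code ::
  "ereal mat \<Rightarrow> nat \<Rightarrow> 'q::{finite,field} mat \<Rightarrow> (nat \<Rightarrow> nat) \<Rightarrow>
    (nat \<Rightarrow> 'q vec \<Rightarrow> 'q vec \<Rightarrow> 'q) \<Rightarrow> bool" where
  "linear_code P l A D G \<longleftrightarrow>
     A \<in> carrier_mat l (dim_col P) \<and>
     (\<forall>i < dim_row P.
        D i \<in> {..<dim_col P} - side_info P i \<and>
        (\<forall>x \<in> carrier_vec (dim_col P). G i (A *\<^sub>v x) (subvec x (side_info P i)) = x $ D i))"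

definition satisfaction :: "ereal mat \<Rightarrow> (nat \<Rightarrow> nat) \<Rightarrow> ereal" where
  "satisfaction P D = (\<Sum>i < dim_row P. P $$ (i, D i))"

definition achievable :: "'q::{finite,field} itself \<Rightarrow> ereal mat \<Rightarrow> nat \<Rightarrow> ereal \<Rightarrow> bool" where
  "achievable TYPE('q) P l s \<longleftrightarrow>
     (\<exists>(A :: 'q mat) D G. linear_code P l A D G \<and> s = satisfaction P D)"

end

theory Submission
  imports Defs
begin

text \<open>
  Receiver 0 knows nothing and prefers message 0 to message 1; receiver 1 knows message 0, so it
  must decode message 1. If receiver 0 decoded message 0, receiver 1 could be simulated at
  receiver 0, and both messages would be recovered from one symbol. So with length 1
  receiver 0 has to decode message 1, although its other choice would change the
  satisfaction metric.
\<close>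

definition example_pref :: "ereal mat" where
  "example_pref = mat 2 2 (\<lambda>(i, j). if i = 0 then (if j = 0 then 0 else 1)
                                     else (if j = 0 then \<infinity> else 0))"

lemma dim_example_pref [simp]: "dim_row example_pref = 2" "dim_col example_pref = 2"
  by (simp_all add: example_pref_def)

lemma example_pref_index:
  "example_pref $$ (0, 0) = 0" "example_pref $$ (0, Suc 0) = 1"
  "example_pref $$ (Suc 0, 0) = \<infinity>" "example_pref $$ (Suc 0, Suc 0) = 0"
  by (simp_all add: example_pref_def)

lemma side_info_example_pref [simp]:
  "side_info example_pref 0 = {}" "side_info example_pref (Suc 0) = {0}"
  by (auto simp: side_info_def example_pref_def split: if_splits)

lemma ppicod_problem_example_pref: "ppicod_problem example_pref"
  unfolding ppicod_problem_def dim_example_pref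
  by (auto simp: example_pref_index numeral_2_eq_2 less_Suc_eq)

lemma subvec_empty: "subvec x {} = vec_of_list []"
  by (simp add: subvec_def)

lemma subvec_zero:
  assumes "x \<in> carrier_vec 2"
  shows "subvec x {0} = vec_of_list [x $ 0]"
proof -
  have "list_of_vec x = [x $ 0, x $ 1]"
    using assms by (intro nth_equalityI) (auto simp: list_of_vec_index less_2_cases_iff)
  then show ?thesis
    by (simp add: subvec_def nths_Cons)
qed

lemma mult_mat_vec_1_2:
  fixes A :: "'q::comm_ring_1 mat"
  assumes "A \<in> carrier_mat 1 2" "x \<in> carrier_vec 2"
  shows "A *\<^sub>v x = vec 1 (\<lambda>_. A $$ (0, 0) * x $ 0 + A $$ (0, 1) * x $ 1)"
  using assms by (intro eq_vecI) (auto simp: scalar_prod_def numeral_2_eq_2)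

text \<open>Message 1 is sent uncoded. Neither receiver knows it, so both may choose it and read it
  off the only symbol, at ranks 1 and 0.\<close>

lemma achievable_example_pref: "achievable TYPE('q::{finite,field}) example_pref 1 1"
proof -
  define A :: "'q mat" where "A = mat 1 2 (\<lambda>(i, j). of_bool (j = 1))"
  have A: "A \<in> carrier_mat 1 2"
    by (simp add: A_def)
  have "(A *\<^sub>v x) $ 0 = x $ 1" if "x \<in> carrier_vec 2" for x :: "'q vec"
    using mult_mat_vec_1_2[OF A that] by (simp add: A_def)
  then have "linear_code example_pref 1 A (\<lambda>_. 1) (\<lambda>_ y _. y $ 0)"
    using A by (auto simp: linear_code_def less_2_cases_iff)
  moreover have "satisfaction example_pref (\<lambda>_. 1) = 1"
    by (simp add: satisfaction_def numeral_2_eq_2 example_pref_index)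
  ultimately show ?thesis
    unfolding achievable_def by metis
qed

text \<open>The metric depends on a code only through \<open>D 0\<close> and \<open>D 1\<close>, so
  pinning down both leaves a single possible value at length 1.\<close>

lemma linear_code_example_pref_choice:
  fixes A :: "'q::{finite,field} mat"
  assumes "linear_code example_pref 1 A D G"
  shows "D 0 = 1" "D 1 = 1"
proof -
  have A: "A \<in> carrier_mat 1 2"
    and D0: "D 0 < 2" and D1: "D 1 < 2" "D 1 \<noteq> 0"
    and dec0: "\<And>x. x \<in> carrier_vec 2 \<Longrightarrow> G 0 (A *\<^sub>v x) (subvec x {}) = x $ D 0"
    and dec1: "\<And>x. x \<in> carrier_vec 2 \<Longrightarrow> G 1 (A *\<^sub>v x) (subvec x {0}) = x $ D 1"
    using assms by (auto simp: linear_code_def numeral_2_eq_2)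
  show "D 1 = 1"
    using D1 by simp
  show "D 0 = 1"
  proof (rule ccontr)
    assume "D 0 \<noteq> 1"
    with D0 have "D 0 = 0" by simp
    define v where "v a b = vec 2 (\<lambda>i. if i = 0 then a else b)" for a b :: 'q
    have v: "v a b \<in> carrier_vec 2" "v a b $ 0 = a" "v a b $ 1 = b" for a b
      by (simp_all add: v_def)
    have enc: "A *\<^sub>v v a b = vec 1 (\<lambda>_. A $$ (0, 0) * a + A $$ (0, 1) * b)" for a b
      using mult_mat_vec_1_2[OF A v(1)] by (simp only: v(2,3))
    \<comment> \<open>\<open>(A\<^sub>0\<^sub>1, -A\<^sub>0\<^sub>0)\<close> is in the kernel of \<open>A\<close>.\<close>
    have "A *\<^sub>v v (A $$ (0, 1)) (- A $$ (0, 0)) = A *\<^sub>v v 0 0"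
      by (simp add: enc)
    \<comment> \<open>Having no side information, receiver 0 gives the same output on equal
      codewords, but message 0 is \<open>A $$ (0, 1)\<close> in one vector and 0 in the
      other.\<close>
    then have A01: "A $$ (0, 1) = 0"
      using dec0[OF v(1)] \<open>D 0 = 0\<close> by (metis subvec_empty v(2))
    \<comment> \<open>The codeword is now independent of message 1. As \<open>v 0 1\<close> and
      \<open>v 0 0\<close> also agree in message 0, receiver 1 cannot tell them apart, yet it must
      output 1 for one and 0 for the other.\<close>
    then have "A *\<^sub>v v 0 1 = A *\<^sub>v v 0 0"
      by (simp add: enc)
    then have "(1::'q) = 0"
      using dec1[OF v(1)] \<open>D 1 = 1\<close> by (metis subvec_zero v)
    then show False by simp
  qed
qed

theorem proposition2:
  "\<exists>(P :: ereal mat) (l :: nat) (s :: ereal).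
     ppicod_problem P \<and>
     achievable TYPE('q::{finite,field}) P l s \<and>
     (\<forall>s'. s' \<noteq> s \<longrightarrow> \<not> achievable TYPE('q) P l s')"
proof (intro exI conjI allI impI notI)
  show "ppicod_problem example_pref"
    by (rule ppicod_problem_example_pref)
  show "achievable TYPE('q) example_pref 1 1"
    by (rule achievable_example_pref)
  fix s'
  assume "s' \<noteq> 1" "achievable TYPE('q) example_pref 1 s'"
  then obtain A :: "'q mat" and D G
    where "linear_code example_pref 1 A D G" "s' = satisfaction example_pref D"
    unfolding achievable_def by blast
  with \<open>s' \<noteq> 1\<close> show False
    using linear_code_example_pref_choice[of A D G]
    by (simp add: satisfaction_def numeral_2_eq_2 example_pref_index)
qed

end
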